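(* Let $b,p\in(0,\infty)$ and $\kappa\in\mathbb{N}$ (with $p\le1$ whenever $I_{\mathrm{G,IB}}$ is considered). The two rate functions $I_{\mathrm{G,IB}}$ and $I_{\mathrm{L,IB}}$ are both strictly convex and possess the same unique minimizer $(a_{\mathrm{IB}}(p,\kappa),s_{\mathrm{IB}}(p,\kappa),r_{\mathrm{IB}}(p,\kappa))$, given by $$a_{\mathrm{IB}}(p,\kappa)=pb=\mathbb{E}_{\mathrm{Poi}_{bp}}(X),$$ $$s_{\mathrm{IB}}(p,\kappa)=e^{-bp}\sum_{i=0}^{\kappa}i\frac{(bp)^i}{i!}=\mathbb{E}_{\mathrm{Poi}_{bp}}\big[X\mathbf 1\{X\le\kappa\}\big]=bp\,e^{-bp}\sum_{i=0}^{\kappa-1}\frac{(bp)^i}{i!},$$ $$r_{\mathrm{IB}}(p,\kappa)=e^{-bp}\sum_{i=0}^{\kappa}\frac{(bp)^i}{i!}=\mathrm{Poi}_{bp}([0,\kappa]).$$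
   Context: Notation. $\mathbb{N}_0=\{0,1,2,\dots\}$; $\mathcal M_1(\mathbb{N}_0)$ is the set of probability measures on $\mathbb{N}_0$; $\mathrm{Poi}_\alpha(k)=e^{-\alpha}\alpha^k/k!$; $\mathbb{E}_{\mathrm{Poi}_{\alpha}}$ is expectation for a $\mathrm{Poi}_\alpha$-distributed random variable $X$; $H(\mu|\nu)=\sum_k\mu_k\log\frac{\mu_k}{\nu_k}$ (relative entropy, with $0\log0=0$). The rate functions are defined for $(a,s,r)\in[0,\infty)\times[0,\infty)\times[0,1]$ by $$I_{\mathrm{L,IB}}(a,s,r)=\inf\Big\{H(\mu|\mathrm{Poi}_{bp})\colon\mu\in\mathcal M_1(\mathbb{N}_0),\ \sum_{k\in\mathbb{N}_0}k\mu_k=a,\ \sum_{k\le\kappa}k\mu_k=s,\ \sum_{k\le\kappa}\mu_k=r\Big\}$$ ($\inf\emptyset=+\infty$), and, for $p\le1$, $$I_{\mathrm{G,IB}}(a,s,r)=I_{\mathrm{L,IB}}(a,s,r)+(b-a)\log\frac{1-\frac ab}{1-p}+a-bp,$$ with the conventions that $I_{\mathrm{G,IB}}=+\infty$ for $a>b$, and that $(b-a)\log\frac{1-a/b}{1-p}$ is $0$ for $a=b$ and $+\infty$ if $p=1$ and $a<b$. Strict convexity of these $[0,\infty]$-valued functions is understood on the set where they are finite. (They are the large-deviation rate functions of $\frac1N$ times (number of attempts, number of successes, number of successful slots) in the interference-based slotted ALOHA model with local, resp. global, access rule.) *)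

theory Defs
  imports "HOL-Probability.Probability"
begin

text \<open>
  Relative entropy of probability measures on the natural numbers. The negative parts of the
  summands are always summable, since
  \<open>\<mu>\<^sub>k ln (\<mu>\<^sub>k / \<nu>\<^sub>k) \<ge> \<mu>\<^sub>k - \<nu>\<^sub>k\<close> when \<open>\<nu>\<^sub>k > 0\<close>, so for \<open>\<mu> \<lless> \<nu>\<close> the series either
  converges or has the value \<open>+\<infinity>\<close>. The convention \<open>0 log 0 = 0\<close> holds because \<open>0 * x = 0\<close>; the
  support condition is needed because a summand with \<open>\<nu>\<^sub>k = 0 < \<mu>\<^sub>k\<close> would evaluate to \<open>0\<close>.
\<close>

definition relative_entropy :: "nat pmf \<Rightarrow> nat pmf \<Rightarrow> ereal" where
  "relative_entropy \<mu> \<nu> =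
     (if set_pmf \<mu> \<subseteq> set_pmf \<nu> \<and> summable (\<lambda>k. pmf \<mu> k * ln (pmf \<mu> k / pmf \<nu> k))
      then ereal (\<Sum>k. pmf \<mu> k * ln (pmf \<mu> k / pmf \<nu> k))
      else \<infinity>)"

definition rate_domain :: "(real \<times> real \<times> real) set" where
  "rate_domain = {0..} \<times> {0..} \<times> {0..1}"

text \<open>The infimum is taken in the extended reals, where \<open>Inf {} = \<infinity>\<close>.\<close>

definition I_L_IB :: "real \<Rightarrow> real \<Rightarrow> nat \<Rightarrow> real \<times> real \<times> real \<Rightarrow> ereal" where
  "I_L_IB b p \<kappa> = (\<lambda>(a, s, r).
     Inf {relative_entropy \<mu> (poisson_pmf (b * p)) | \<mu>.
            (\<lambda>k. real k * pmf \<mu> k) sums a \<and>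
            (\<Sum>k\<le>\<kappa>. real k * pmf \<mu> k) = s \<and>
            (\<Sum>k\<le>\<kappa>. pmf \<mu> k) = r})"

text \<open>Only meaningful for \<open>p \<le> 1\<close>.\<close>

definition I_G_IB :: "real \<Rightarrow> real \<Rightarrow> nat \<Rightarrow> real \<times> real \<times> real \<Rightarrow> ereal" where
  "I_G_IB b p \<kappa> = (\<lambda>(a, s, r).
     if a > b then \<infinity>
     else if a = b then I_L_IB b p \<kappa> (a, s, r) + ereal (a - b * p)
     else if p = 1 then \<infinity>
     else I_L_IB b p \<kappa> (a, s, r)
            + ereal ((b - a) * ln ((1 - a / b) / (1 - p)) + a - b * p))"

text \<open>
  Strict convexity on \<open>D\<close> of an extended-real-valued function, understood on the set where the
  function is finite; this set is itself required to be convex.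
\<close>

definition strictly_convex_where_finite ::
    "'a::real_vector set \<Rightarrow> ('a \<Rightarrow> ereal) \<Rightarrow> bool" where
  "strictly_convex_where_finite D f \<longleftrightarrow>
     (let F = {x \<in> D. \<bar>f x\<bar> \<noteq> \<infinity>} in
      convex F \<and>
      (\<forall>x\<in>F. \<forall>y\<in>F. \<forall>t. x \<noteq> y \<and> 0 < t \<and> t < 1 \<longrightarrow>
         f ((1 - t) *\<^sub>R x + t *\<^sub>R y) < ereal (1 - t) * f x + ereal t * f y))"

definition minimizers :: "'a set \<Rightarrow> ('a \<Rightarrow> ereal) \<Rightarrow> 'a set" where
  "minimizers D f = {x. is_arg_min f (\<lambda>y. y \<in> D) x}"

end

theory Submission
  imports Defs
begin

text \<open>
  Both rate functions are strictly convex because relative entropy is, provided that the strict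
  inequality survives the infimum over all measures with a given profile
  \<open>(a, s, r)\<close>. The usual argument picks minimizing measures, which exist by compactness of
  entropy balls. The argument here makes strict convexity quantitative instead, so that
  almost-minimizing measures are good enough and no topology on measures enters.

  The quantitative convexity comes from a single inequality,
  \<open>x ln (x / z) \<ge> x - z + (sqrt x - sqrt z)\<^sup>2\<close>. Summed over the points of \<open>\<nat>\<close>, it shows that
  the entropy of the mixture \<open>(1 - t) \<mu>\<^sub>0 + t \<mu>\<^sub>1\<close> lies below the chord by at least
  \<open>t (1 - t) / 4 * (\<mu>\<^sub>0 k - \<mu>\<^sub>1 k)\<^sup>2\<close>, for every \<open>k\<close> (\<open>entropy_mixture_gap\<close>). It then suffices that
  two measures with different profiles and entropy at most \<open>C\<close> differ at some point by at least
  a fixed \<open>\<delta> > 0\<close> (\<open>profiles_separate\<close>). For \<open>s\<close> and \<open>r\<close> this is clear, as they depend on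
  finitely many point masses. The mean \<open>a\<close> does not, but the Poisson distribution has all
  exponential moments, and Young's inequality bounds the tails of the mean uniformly over an
  entropy ball (\<open>mean_tail_uniform\<close>), so a change of \<open>a\<close> is also visible on finitely many points.

  The global rate function arises from the local one by adding a term in \<open>a\<close> alone. With
  \<open>u = b - a\<close> and \<open>v = b (1 - p)\<close> this term is, for \<open>a \<le> b\<close> and \<open>p < 1\<close>, equal to
  \<open>u ln (u / v) - u + v\<close>, which the same inequality shows to be convex and nonnegative. For
  \<open>p = 1\<close> it is \<open>0\<close> at \<open>a = b\<close> and \<open>\<infinity>\<close> elsewhere.

  Finally, both functions are nonnegative and vanish at the profile of the Poisson distribution
  itself. A nonnegative strictly convex function has at most one zero, so this profile is the
  unique minimizer of both.
\<close>

section \<open>Quantitative convexity of \<open>x ln x\<close>\<close>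

text \<open>
  This is \<open>ln w \<le> w - 1\<close> at \<open>w = sqrt (z / x)\<close>. Applied at \<open>w = z / x\<close> the same bound would only
  give \<open>x - z\<close>; taking the root first is what produces the square.
\<close>

lemma xlnx_ge_hellinger:
  fixes x z :: real
  assumes "x \<ge> 0" "z > 0"
  shows "x * ln (x / z) \<ge> x - z + (sqrt x - sqrt z)\<^sup>2"
proof (cases "x = 0")
  case True
  then show ?thesis using assms by simp
next
  case False
  then have x: "x > 0" using assms by simp
  have "ln (z / x) = 2 * ln (sqrt (z / x))"
    using x assms by (simp add: ln_sqrt)
  also have "\<dots> \<le> 2 * (sqrt (z / x) - 1)"
    using ln_le_minus_one[of "sqrt (z / x)"] x assms by simp
  finally have "x * ln (x / z) \<ge> x * (2 - 2 * sqrt (z / x))"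
    using x assms by (intro mult_left_mono) (auto simp: ln_div)
  moreover have "x * sqrt (z / x) = sqrt x * sqrt z"
    using x assms by (simp add: real_sqrt_divide field_simps)
  moreover have "(sqrt x - sqrt z)\<^sup>2 = x + z - 2 * (sqrt x * sqrt z)"
    using x assms by (simp add: power2_diff)
  ultimately show ?thesis by (simp add: algebra_simps)
qed

lemma xlnx_ge_diff:
  fixes x z :: real
  assumes "x \<ge> 0" "z > 0"
  shows "x * ln (x / z) \<ge> x - z"
  using xlnx_ge_hellinger[OF assms] zero_le_power2[of "sqrt x - sqrt z"] by linarith

text \<open>Young's inequality for the dual pair \<open>x ln x - x\<close> and \<open>exp c\<close>, relative to the weight \<open>q\<close>.\<close>

lemma young_exp:
  fixes x q c :: real
  assumes "x \<ge> 0" "q > 0"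
  shows "c * x \<le> x * ln (x / q) - x + q * exp c"
proof (cases "x = 0")
  case True
  then show ?thesis using assms by simp
next
  case False
  then have "x * ln (x / (q * exp c)) = x * ln (x / q) - c * x"
    using assms by (simp add: ln_div ln_mult algebra_simps)
  then show ?thesis using xlnx_ge_diff[of x "q * exp c"] assms by simp
qed

lemma sqrt_diff_squared_ge:
  fixes x z B :: real
  assumes "0 \<le> x" "x \<le> B" "0 \<le> z" "z \<le> B" "B > 0"
  shows "(sqrt x - sqrt z)\<^sup>2 \<ge> (x - z)\<^sup>2 / (4 * B)"
proof -
  have "x - z = (sqrt x - sqrt z) * (sqrt x + sqrt z)"
    using assms by (simp add: algebra_simps)
  then have "(x - z)\<^sup>2 = (sqrt x - sqrt z)\<^sup>2 * (sqrt x + sqrt z)\<^sup>2"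
    by (simp add: power_mult_distrib)
  also have "\<dots> \<le> (sqrt x - sqrt z)\<^sup>2 * (2 * sqrt B)\<^sup>2"
  proof (intro mult_left_mono power_mono)
    show "sqrt x + sqrt z \<le> 2 * sqrt B"
      using real_sqrt_le_mono[OF assms(2)] real_sqrt_le_mono[OF assms(4)] by linarith
  qed (use assms in auto)
  also have "\<dots> = (sqrt x - sqrt z)\<^sup>2 * (4 * B)"
    using assms by (simp add: power_mult_distrib)
  finally show ?thesis using assms by (simp add: divide_le_eq)
qed

lemma xlnx_convex_gap:
  fixes x y q t B :: real
  assumes "0 \<le> x" "x \<le> B" "0 \<le> y" "y \<le> B" "B > 0" "q > 0" "0 < t" "t < 1"
  defines "z \<equiv> (1 - t) * x + t * y"
  shows "z * ln (z / q) \<le> (1 - t) * (x * ln (x / q)) + t * (y * ln (y / q))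
    - t * (1 - t) / (4 * B) * (x - y)\<^sup>2"
proof (cases "z = 0")
  case True
  then have "(1 - t) * x = 0" "t * y = 0"
    using assms(1,3,7,8) unfolding z_def by (simp_all add: add_nonneg_eq_0_iff)
  then show ?thesis using True assms(7,8) by simp
next
  case False
  have z0: "z \<ge> 0" unfolding z_def using assms(1,3,7,8) by simp
  then have z: "z > 0" using False by simp
  have zB: "z \<le> B" unfolding z_def
    using convex_bound_le[of x B y "1 - t" t] assms(2,4,7,8) by simp
  \<comment> \<open>Pass from the reference value \<open>q\<close> to the mixture \<open>z\<close>, at the cost of a term linear in \<open>w\<close>.\<close>
  have lower: "w * ln (w / q) \<ge> w - z + (w - z)\<^sup>2 / (4 * B) + w * ln (z / q)"
    if "0 \<le> w" "w \<le> B" for w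
  proof -
    have "w * ln (w / q) = w * ln (w / z) + w * ln (z / q)"
      using that z \<open>q > 0\<close> by (cases "w = 0") (auto simp: ln_div algebra_simps)
    then show ?thesis
      using xlnx_ge_hellinger[OF that(1) z] sqrt_diff_squared_ge[OF that z0 zB \<open>B > 0\<close>] by linarith
  qed
  have "(1 - t) * (x * ln (x / q)) + t * (y * ln (y / q)) \<ge>
    (1 - t) * (x - z + (x - z)\<^sup>2 / (4 * B) + x * ln (z / q)) +
    t * (y - z + (y - z)\<^sup>2 / (4 * B) + y * ln (z / q))"
    using assms(7,8) lower[OF assms(1,2)] lower[OF assms(3,4)]
    by (intro add_mono mult_left_mono) auto
  also have "(1 - t) * (x - z + (x - z)\<^sup>2 / (4 * B) + x * ln (z / q)) +
    t * (y - z + (y - z)\<^sup>2 / (4 * B) + y * ln (z / q)) =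
    ((1 - t) * (x - z) + t * (y - z)) + ((1 - t) * (x - z)\<^sup>2 + t * (y - z)\<^sup>2) / (4 * B)
    + z * ln (z / q)"
    unfolding z_def by (simp add: algebra_simps add_divide_distrib diff_divide_distrib)
  also have "(1 - t) * (x - z) + t * (y - z) = 0"
    unfolding z_def by (simp add: algebra_simps)
  also have "(1 - t) * (x - z)\<^sup>2 + t * (y - z)\<^sup>2 = t * (1 - t) * (x - y)\<^sup>2"
    unfolding z_def by (simp add: algebra_simps power2_eq_square)
  finally show ?thesis by simp
qed

section \<open>Relative entropy of mixtures\<close>

lemma pmf_nat_sums_1: "pmf (\<mu> :: nat pmf) sums 1"
proof -
  have "has_bochner_integral (count_space UNIV) (pmf \<mu>) 1"
    by (simp add: has_bochner_integral_iff integrable_pmf integral_pmf)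
  then show ?thesis
    using sums_integral_count_space_nat[of "pmf \<mu>"] by (simp add: has_bochner_integral_iff)
qed

text \<open>
  The difference of entropy summand and \<open>\<mu> k - \<nu> k\<close> is the natural summand to work with: it has
  the same sum, and it is nonnegative.
\<close>

lemma entropy_summand_nonneg:
  fixes \<mu> \<nu> :: "nat pmf"
  assumes "set_pmf \<nu> = UNIV"
  shows "pmf \<mu> k * ln (pmf \<mu> k / pmf \<nu> k) - pmf \<mu> k + pmf \<nu> k \<ge> 0"
  using xlnx_ge_diff[of "pmf \<mu> k" "pmf \<nu> k"] pmf_positive[of k \<nu>] assms by simp

lemma entropy_summand_sums:
  fixes \<mu> \<nu> :: "nat pmf"
  assumes "(\<lambda>k. pmf \<mu> k * ln (pmf \<mu> k / pmf \<nu> k)) sums h"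
  shows "(\<lambda>k. pmf \<mu> k * ln (pmf \<mu> k / pmf \<nu> k) - pmf \<mu> k + pmf \<nu> k) sums h"
  using sums_add[OF sums_diff[OF assms pmf_nat_sums_1[of \<mu>]] pmf_nat_sums_1[of \<nu>]] by simp

lemma relative_entropy_eq_iff_sums:
  assumes "set_pmf \<nu> = UNIV"
  shows "relative_entropy \<mu> \<nu> = ereal h \<longleftrightarrow> (\<lambda>k. pmf \<mu> k * ln (pmf \<mu> k / pmf \<nu> k)) sums h"
  using assms by (auto simp: relative_entropy_def sums_iff)

lemma relative_entropy_nonneg:
  assumes "set_pmf \<nu> = UNIV"
  shows "relative_entropy \<mu> \<nu> \<ge> 0"
proof (cases "summable (\<lambda>k. pmf \<mu> k * ln (pmf \<mu> k / pmf \<nu> k))")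
  case True
  then show ?thesis
    using sums_le[OF _ sums_zero entropy_summand_sums[OF summable_sums[OF True]]]
      entropy_summand_nonneg[OF assms] by (simp add: relative_entropy_def)
qed (simp add: relative_entropy_def)

lemma relative_entropy_less_ereal_cases:
  assumes "set_pmf \<nu> = UNIV" "relative_entropy \<mu> \<nu> < ereal c"
  obtains h where "(\<lambda>k. pmf \<mu> k * ln (pmf \<mu> k / pmf \<nu> k)) sums h" "h < c"
  using assms relative_entropy_nonneg[OF assms(1), of \<mu>]
    relative_entropy_eq_iff_sums[OF assms(1), of \<mu>]
  by (cases "relative_entropy \<mu> \<nu>") auto

definition mixture_pmf :: "real \<Rightarrow> 'a pmf \<Rightarrow> 'a pmf \<Rightarrow> 'a pmf" where
  "mixture_pmf t \<mu>\<^sub>0 \<mu>\<^sub>1 = bernoulli_pmf t \<bind> (\<lambda>c. if c then \<mu>\<^sub>1 else \<mu>\<^sub>0)"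

lemma pmf_mixture:
  assumes "0 < t" "t < 1"
  shows "pmf (mixture_pmf t \<mu>\<^sub>0 \<mu>\<^sub>1) k = (1 - t) * pmf \<mu>\<^sub>0 k + t * pmf \<mu>\<^sub>1 k"
  using assms by (simp add: mixture_pmf_def pmf_bind)

lemma entropy_mixture_gap:
  fixes \<mu>\<^sub>0 \<mu>\<^sub>1 \<nu> :: "nat pmf"
  assumes \<nu>: "set_pmf \<nu> = UNIV" and t: "0 < t" "t < 1"
    and h0: "(\<lambda>k. pmf \<mu>\<^sub>0 k * ln (pmf \<mu>\<^sub>0 k / pmf \<nu> k)) sums h\<^sub>0"
    and h1: "(\<lambda>k. pmf \<mu>\<^sub>1 k * ln (pmf \<mu>\<^sub>1 k / pmf \<nu> k)) sums h\<^sub>1"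
  shows "relative_entropy (mixture_pmf t \<mu>\<^sub>0 \<mu>\<^sub>1) \<nu>
    \<le> ereal ((1 - t) * h\<^sub>0 + t * h\<^sub>1 - t * (1 - t) / 4 * (pmf \<mu>\<^sub>0 j - pmf \<mu>\<^sub>1 j)\<^sup>2)"
proof -
  define m where "m = mixture_pmf t \<mu>\<^sub>0 \<mu>\<^sub>1"
  define S where "S \<mu> k = pmf \<mu> k * ln (pmf \<mu> k / pmf \<nu> k) - pmf \<mu> k + pmf \<nu> k" for \<mu> k
  define G where "G k = t * (1 - t) / 4 * (pmf \<mu>\<^sub>0 k - pmf \<mu>\<^sub>1 k)\<^sup>2" for k
  have S_nonneg: "S \<mu> k \<ge> 0" for \<mu> k
    unfolding S_def by (rule entropy_summand_nonneg[OF \<nu>])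
  have S0: "S \<mu>\<^sub>0 sums h\<^sub>0" and S1: "S \<mu>\<^sub>1 sums h\<^sub>1"
    unfolding S_def using entropy_summand_sums[OF h0] entropy_summand_sums[OF h1] .
  have pointwise: "S m k \<le> (1 - t) * S \<mu>\<^sub>0 k + t * S \<mu>\<^sub>1 k - G k" for k
    using xlnx_convex_gap[of "pmf \<mu>\<^sub>0 k" 1 "pmf \<mu>\<^sub>1 k" "pmf \<nu> k" t] t pmf_positive[of k \<nu>] \<nu>
    by (simp add: S_def G_def m_def pmf_mixture pmf_le_1 algebra_simps)
  have G_nonneg: "G k \<ge> 0" for k
    unfolding G_def using t by simp
  have chord: "(\<lambda>k. (1 - t) * S \<mu>\<^sub>0 k + t * S \<mu>\<^sub>1 k) sums ((1 - t) * h\<^sub>0 + t * h\<^sub>1)"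
    by (intro sums_add sums_mult S0 S1)
  \<comment> \<open>Of the gaps at all the points, only the one at \<open>j\<close> is kept.\<close>
  have chord_gap: "(\<lambda>k. (1 - t) * S \<mu>\<^sub>0 k + t * S \<mu>\<^sub>1 k - (if k = j then G k else 0))
      sums ((1 - t) * h\<^sub>0 + t * h\<^sub>1 - G j)"
    using sums_diff[OF chord sums_single[of j G]] .
  have le: "S m k \<le> (1 - t) * S \<mu>\<^sub>0 k + t * S \<mu>\<^sub>1 k - (if k = j then G k else 0)" for k
    using pointwise[of k] G_nonneg[of k] by auto
  have "summable (S m)"
    using S_nonneg le by (intro summable_comparison_test'[OF sums_summable[OF chord_gap], of 0]) auto
  then obtain h where h: "S m sums h" by (auto simp: summable_def)
  have "(\<lambda>k. S m k + pmf m k - pmf \<nu> k) sums (h + 1 - 1)"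
    by (intro sums_add sums_diff h pmf_nat_sums_1)
  then have "(\<lambda>k. pmf m k * ln (pmf m k / pmf \<nu> k)) sums h"
    by (simp add: S_def)
  then have "relative_entropy m \<nu> = ereal h"
    by (simp add: relative_entropy_eq_iff_sums[OF \<nu>])
  moreover have "h \<le> (1 - t) * h\<^sub>0 + t * h\<^sub>1 - G j"
    by (rule sums_le[OF le h chord_gap])
  ultimately show ?thesis by (simp add: m_def G_def)
qed

section \<open>Profiles of measures of bounded entropy\<close>

definition has_profile :: "nat \<Rightarrow> nat pmf \<Rightarrow> real \<times> real \<times> real \<Rightarrow> bool" where
  "has_profile \<kappa> \<mu> = (\<lambda>(a, s, r). (\<lambda>k. real k * pmf \<mu> k) sums a \<and>
     (\<Sum>k\<le>\<kappa>. real k * pmf \<mu> k) = s \<and> (\<Sum>k\<le>\<kappa>. pmf \<mu> k) = r)"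

lemma I_L_IB_eq_INF:
  "I_L_IB b p \<kappa> x = (INF \<mu>\<in>{\<mu>. has_profile \<kappa> \<mu> x}. relative_entropy \<mu> (poisson_pmf (b * p)))"
  by (cases x) (auto simp: I_L_IB_def has_profile_def setcompr_eq_image)

lemma has_profile_mixture:
  assumes "has_profile \<kappa> \<mu>\<^sub>0 x" "has_profile \<kappa> \<mu>\<^sub>1 y" "0 < t" "t < 1"
  shows "has_profile \<kappa> (mixture_pmf t \<mu>\<^sub>0 \<mu>\<^sub>1) ((1 - t) *\<^sub>R x + t *\<^sub>R y)"
proof -
  obtain a s r a' s' r' where xy: "x = (a, s, r)" "y = (a', s', r')"
    by (cases x, cases y) auto
  have "(\<lambda>k. (1 - t) * (real k * pmf \<mu>\<^sub>0 k) + t * (real k * pmf \<mu>\<^sub>1 k)) sums ((1 - t) * a + t * a')"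
    using assms(1,2) unfolding xy has_profile_def by (intro sums_add sums_mult) auto
  then show ?thesis
    using assms unfolding xy has_profile_def
    by (auto simp: pmf_mixture sum.distrib sum_distrib_left distrib_left mult.left_commute)
qed

text \<open>
  Young's inequality with slope \<open>c\<close> bounds \<open>c\<close> times the tail of the mean by the entropy plus a
  tail of the exponential moment of order \<open>c\<close>. A large slope makes the entropy negligible,
  and a large cutoff \<open>M\<close> then does the same for the moment.
\<close>

lemma mean_tail_uniform:
  fixes \<nu> :: "nat pmf"
  assumes \<nu>: "set_pmf \<nu> = UNIV"
    and exp_moments: "\<And>c. summable (\<lambda>k. pmf \<nu> k * exp (c * real k))"
    and "\<epsilon> > 0"
  obtains M where "\<And>\<mu> h a. (\<lambda>k. pmf \<mu> k * ln (pmf \<mu> k / pmf \<nu> k)) sums h \<Longrightarrow> h \<le> C \<Longrightarrow>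
    (\<lambda>k. real k * pmf \<mu> k) sums a \<Longrightarrow>
    (\<Sum>k<M. real k * pmf \<mu> k) \<le> a \<and> a \<le> (\<Sum>k<M. real k * pmf \<mu> k) + \<epsilon>"
proof -
  define c where "c = (\<bar>C\<bar> + 1) / \<epsilon>"
  have c: "c > 0" "c * \<epsilon> = \<bar>C\<bar> + 1" using \<open>\<epsilon> > 0\<close> by (auto simp: c_def)
  define E where "E k = pmf \<nu> k * exp (c * real k)" for k
  have E: "summable E" unfolding E_def by (rule exp_moments)
  obtain M where M: "norm (\<Sum>k. E (k + M)) < 1"
    using suminf_exist_split[OF zero_less_one E] by blast
  have "(\<Sum>k<M. real k * pmf \<mu> k) \<le> a \<and> a \<le> (\<Sum>k<M. real k * pmf \<mu> k) + \<epsilon>"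
    if h: "(\<lambda>k. pmf \<mu> k * ln (pmf \<mu> k / pmf \<nu> k)) sums h" "h \<le> C"
      and a: "(\<lambda>k. real k * pmf \<mu> k) sums a" for \<mu> h a
  proof -
    define S where "S k = pmf \<mu> k * ln (pmf \<mu> k / pmf \<nu> k) - pmf \<mu> k + pmf \<nu> k" for k
    have S: "S sums h" unfolding S_def by (rule entropy_summand_sums[OF h(1)])
    have S_nonneg: "S k \<ge> 0" for k unfolding S_def by (rule entropy_summand_nonneg[OF \<nu>])
    define A where "A = (\<Sum>k<M. real k * pmf \<mu> k)"
    have tail: "(\<lambda>k. real (k + M) * pmf \<mu> (k + M)) sums (a - A)"
      unfolding A_def using sums_split_initial_segment[OF a] .
    have S_tail: "(\<lambda>k. S (k + M)) sums (h - (\<Sum>k<M. S k))"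
      using sums_split_initial_segment[OF S] .
    have E_tail: "(\<lambda>k. E (k + M)) sums (\<Sum>k. E (k + M))"
      using E by (intro summable_sums summable_ignore_initial_segment)
    have young: "c * (real k * pmf \<mu> k) \<le> S k + E k" for k
      using young_exp[of "pmf \<mu> k" "pmf \<nu> k" "c * real k"] pmf_positive[of k \<nu>] \<nu>
      by (simp add: S_def E_def algebra_simps add_increasing)
    have "c * (a - A) \<le> (h - (\<Sum>k<M. S k)) + (\<Sum>k. E (k + M))"
      using sums_le[OF _ sums_mult[OF tail, of c] sums_add[OF S_tail E_tail]] young by blast
    also have "\<dots> \<le> c * \<epsilon>"
      using M h(2) sum_nonneg[of "{..<M}" S] S_nonneg unfolding c(2) by simp
    finally have "a - A \<le> \<epsilon>" using c(1) by simp
    moreover have "0 \<le> a - A"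
      using sums_le[OF _ sums_zero tail] by simp
    ultimately show ?thesis by (simp add: A_def)
  qed
  then show ?thesis using that by blast
qed

text \<open>
  Contrapositive of the triangle inequality; the summand \<open>1\<close> in the bound makes that inequality
  strict and covers weights that all vanish.
\<close>

lemma weighted_sum_separates:
  fixes w f g :: "nat \<Rightarrow> real"
  assumes "\<bar>(\<Sum>k\<in>A. w k * f k) - (\<Sum>k\<in>A. w k * g k)\<bar> \<ge> d" "d > 0"
  shows "\<exists>k. \<bar>f k - g k\<bar> \<ge> d / ((\<Sum>k\<in>A. \<bar>w k\<bar>) + 1)"
proof (rule ccontr)
  define W where "W = (\<Sum>k\<in>A. \<bar>w k\<bar>)"
  have W: "W \<ge> 0" unfolding W_def by (simp add: sum_nonneg)
  assume "\<not> ?thesis"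
  then have small: "\<bar>f k - g k\<bar> \<le> d / (W + 1)" for k
    by (auto simp: W_def not_le intro: less_imp_le)
  have "\<bar>\<Sum>k\<in>A. w k * (f k - g k)\<bar> \<le> (\<Sum>k\<in>A. \<bar>w k * (f k - g k)\<bar>)"
    by (rule sum_abs)
  also have "\<dots> \<le> (\<Sum>k\<in>A. \<bar>w k\<bar> * (d / (W + 1)))"
    unfolding abs_mult by (intro sum_mono mult_left_mono small) auto
  also have "\<dots> = W * (d / (W + 1))" by (simp only: W_def sum_distrib_right)
  also have "\<dots> < d" using W \<open>d > 0\<close> by (simp add: divide_less_eq algebra_simps)
  finally show False
    using assms(1) by (simp add: algebra_simps sum_subtractf)
qed

lemma profiles_separate:
  fixes \<nu> :: "nat pmf"
  assumes \<nu>: "set_pmf \<nu> = UNIV"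
    and exp_moments: "\<And>c. summable (\<lambda>k. pmf \<nu> k * exp (c * real k))"
    and "x \<noteq> y"
  obtains \<delta> where "\<delta> > 0" "\<And>\<mu>\<^sub>0 \<mu>\<^sub>1 h\<^sub>0 h\<^sub>1. has_profile \<kappa> \<mu>\<^sub>0 x \<Longrightarrow> has_profile \<kappa> \<mu>\<^sub>1 y \<Longrightarrow>
    (\<lambda>k. pmf \<mu>\<^sub>0 k * ln (pmf \<mu>\<^sub>0 k / pmf \<nu> k)) sums h\<^sub>0 \<Longrightarrow> h\<^sub>0 \<le> C \<Longrightarrow>
    (\<lambda>k. pmf \<mu>\<^sub>1 k * ln (pmf \<mu>\<^sub>1 k / pmf \<nu> k)) sums h\<^sub>1 \<Longrightarrow> h\<^sub>1 \<le> C \<Longrightarrow>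
    \<exists>k. \<bar>pmf \<mu>\<^sub>0 k - pmf \<mu>\<^sub>1 k\<bar> \<ge> \<delta>"
proof -
  obtain a s r a' s' r' where xy: "x = (a, s, r)" "y = (a', s', r')"
    by (cases x, cases y) auto
  have pos: "d / ((\<Sum>k\<in>A. \<bar>w k\<bar>) + 1) > 0" if "d > 0" for d and A :: "nat set" and w :: "nat \<Rightarrow> real"
    using that by (intro divide_pos_pos add_nonneg_pos sum_nonneg) auto
  consider "a \<noteq> a'" | "s \<noteq> s'" | "r \<noteq> r'" using \<open>x \<noteq> y\<close> xy by auto
  then show ?thesis
  proof cases
    case 1
    define d where "d = \<bar>a - a'\<bar> / 2"
    have d: "d > 0" using 1 by (simp add: d_def)
    \<comment> \<open>Either mean loses at most \<open>d\<close> by truncation, so the truncated means still differ by \<open>d\<close>.\<close>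
    obtain M where M: "\<And>\<mu> h a. (\<lambda>k. pmf \<mu> k * ln (pmf \<mu> k / pmf \<nu> k)) sums h \<Longrightarrow> h \<le> C \<Longrightarrow>
      (\<lambda>k. real k * pmf \<mu> k) sums a \<Longrightarrow>
      (\<Sum>k<M. real k * pmf \<mu> k) \<le> a \<and> a \<le> (\<Sum>k<M. real k * pmf \<mu> k) + d"
      using mean_tail_uniform[OF \<nu> exp_moments d] by blast
    show ?thesis
    proof (rule that[OF pos[OF d, of real "{..<M}"]])
      fix \<mu>\<^sub>0 \<mu>\<^sub>1 h\<^sub>0 h\<^sub>1
      assume *: "has_profile \<kappa> \<mu>\<^sub>0 x" "has_profile \<kappa> \<mu>\<^sub>1 y"
        "(\<lambda>k. pmf \<mu>\<^sub>0 k * ln (pmf \<mu>\<^sub>0 k / pmf \<nu> k)) sums h\<^sub>0" "h\<^sub>0 \<le> C"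
        "(\<lambda>k. pmf \<mu>\<^sub>1 k * ln (pmf \<mu>\<^sub>1 k / pmf \<nu> k)) sums h\<^sub>1" "h\<^sub>1 \<le> C"
      define A where "A \<mu> = (\<Sum>k<M. real k * pmf \<mu> k)" for \<mu>
      have sums: "(\<lambda>k. real k * pmf \<mu>\<^sub>0 k) sums a" "(\<lambda>k. real k * pmf \<mu>\<^sub>1 k) sums a'"
        using *(1,2) by (simp_all add: xy has_profile_def)
      have "A \<mu>\<^sub>0 \<le> a" "a \<le> A \<mu>\<^sub>0 + d" "A \<mu>\<^sub>1 \<le> a'" "a' \<le> A \<mu>\<^sub>1 + d"
        using M[OF *(3,4) sums(1)] M[OF *(5,6) sums(2)] by (simp_all only: A_def)
      moreover have "2 * d = \<bar>a - a'\<bar>" by (simp add: d_def)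
      ultimately have "\<bar>A \<mu>\<^sub>0 - A \<mu>\<^sub>1\<bar> \<ge> d" by arith
      then have "\<bar>(\<Sum>k<M. real k * pmf \<mu>\<^sub>0 k) - (\<Sum>k<M. real k * pmf \<mu>\<^sub>1 k)\<bar> \<ge> d"
        unfolding A_def .
      then show "\<exists>k. \<bar>pmf \<mu>\<^sub>0 k - pmf \<mu>\<^sub>1 k\<bar> \<ge> d / ((\<Sum>k<M. \<bar>real k\<bar>) + 1)"
        using d by (rule weighted_sum_separates)
    qed
  next
    case 2
    then have d: "\<bar>s - s'\<bar> > 0" by simp
    show ?thesis
    proof (rule that[OF pos[OF d, of real "{..\<kappa>}"]])
      fix \<mu>\<^sub>0 \<mu>\<^sub>1
      assume "has_profile \<kappa> \<mu>\<^sub>0 x" "has_profile \<kappa> \<mu>\<^sub>1 y"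
      then show "\<exists>k. \<bar>pmf \<mu>\<^sub>0 k - pmf \<mu>\<^sub>1 k\<bar> \<ge> \<bar>s - s'\<bar> / ((\<Sum>k\<le>\<kappa>. \<bar>real k\<bar>) + 1)"
        using d by (intro weighted_sum_separates) (auto simp: xy has_profile_def)
    qed
  next
    case 3
    then have d: "\<bar>r - r'\<bar> > 0" by simp
    show ?thesis
    proof (rule that[OF pos[OF d, of "\<lambda>_. 1" "{..\<kappa>}"]])
      fix \<mu>\<^sub>0 \<mu>\<^sub>1
      assume "has_profile \<kappa> \<mu>\<^sub>0 x" "has_profile \<kappa> \<mu>\<^sub>1 y"
      then show "\<exists>k. \<bar>pmf \<mu>\<^sub>0 k - pmf \<mu>\<^sub>1 k\<bar> \<ge> \<bar>r - r'\<bar> / ((\<Sum>k\<le>\<kappa>. \<bar>1\<bar>) + 1)"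
        using d by (intro weighted_sum_separates) (auto simp: xy has_profile_def)
    qed
  qed
qed

section \<open>Strictly convex extended-real functions\<close>

text \<open>
  The value at a convex combination of finite points is bounded by a finite chord, so a
  nonnegative function that satisfies the strict inequality has a convex set of finiteness.
\<close>

lemma strictly_convex_where_finiteI:
  fixes f :: "'a::real_vector \<Rightarrow> ereal"
  assumes D: "convex D" and nonneg: "\<And>x. f x \<ge> 0"
    and strict: "\<And>x y u v t. x \<in> D \<Longrightarrow> y \<in> D \<Longrightarrow> x \<noteq> y \<Longrightarrow> f x = ereal u \<Longrightarrow> f y = ereal v \<Longrightarrow>
      0 < t \<Longrightarrow> t < 1 \<Longrightarrow> f ((1 - t) *\<^sub>R x + t *\<^sub>R y) < ereal ((1 - t) * u + t * v)"
  shows "strictly_convex_where_finite D f"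
proof -
  define F where "F = {x \<in> D. \<bar>f x\<bar> \<noteq> \<infinity>}"
  have strict': "f ((1 - t) *\<^sub>R x + t *\<^sub>R y) < ereal (1 - t) * f x + ereal t * f y"
    if "x \<in> F" "y \<in> F" "x \<noteq> y" "0 < t" "t < 1" for x y t
    using that strict[of x y _ _ t] by (cases "f x"; cases "f y") (auto simp: F_def)
  have "(1 - t) *\<^sub>R x + t *\<^sub>R y \<in> F" if "x \<in> F" "y \<in> F" "0 \<le> t" "t \<le> 1" for x y t
  proof (cases "x = y \<or> t = 0 \<or> t = 1")
    case True
    then show ?thesis using that by (auto simp flip: scaleR_add_left)
  next
    case False
    then have "f ((1 - t) *\<^sub>R x + t *\<^sub>R y) < \<infinity>"
      using strict'[of x y t] that by (auto intro: less_le_trans)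
    moreover have "(1 - t) *\<^sub>R x + t *\<^sub>R y \<in> D"
      using D that by (auto simp: F_def convex_alt)
    ultimately show ?thesis
      using nonneg[of "(1 - t) *\<^sub>R x + t *\<^sub>R y"] by (auto simp: F_def)
  qed
  then have "convex F" by (simp add: convex_alt)
  then show ?thesis
    unfolding strictly_convex_where_finite_def Let_def F_def[symmetric] using strict' by blast
qed

lemma strictly_convex_where_finiteD:
  assumes "strictly_convex_where_finite D f" "x \<in> D" "y \<in> D" "x \<noteq> y"
    and "f x = ereal u" "f y = ereal v" "0 < t" "t < 1"
  shows "f ((1 - t) *\<^sub>R x + t *\<^sub>R y) < ereal ((1 - t) * u + t * v)"
  using assms unfolding strictly_convex_where_finite_def Let_def by fastforce

lemma strictly_convex_where_finite_add:
  fixes f g :: "'a::real_vector \<Rightarrow> ereal"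
  assumes D: "convex D" and f: "strictly_convex_where_finite D f"
    and nonneg: "\<And>x. f x \<ge> 0" "\<And>x. g x \<ge> 0"
    and g: "\<And>x y u v t. x \<in> D \<Longrightarrow> y \<in> D \<Longrightarrow> g x = ereal u \<Longrightarrow> g y = ereal v \<Longrightarrow>
      0 < t \<Longrightarrow> t < 1 \<Longrightarrow> g ((1 - t) *\<^sub>R x + t *\<^sub>R y) \<le> ereal ((1 - t) * u + t * v)"
  shows "strictly_convex_where_finite D (\<lambda>x. f x + g x)"
proof (rule strictly_convex_where_finiteI[OF D])
  show "f x + g x \<ge> 0" for x using nonneg by simp
next
  fix x y u v and t :: real
  assume xy: "x \<in> D" "y \<in> D" "x \<noteq> y" and t: "0 < t" "t < 1"
    and "f x + g x = ereal u" "f y + g y = ereal v"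
  then obtain u1 u2 v1 v2 where uv: "f x = ereal u1" "g x = ereal u2" "u = u1 + u2"
    "f y = ereal v1" "g y = ereal v2" "v = v1 + v2"
    using nonneg[of x] nonneg[of y]
    by (cases "f x"; cases "g x"; cases "f y"; cases "g y") auto
  have "f ((1 - t) *\<^sub>R x + t *\<^sub>R y) + g ((1 - t) *\<^sub>R x + t *\<^sub>R y)
      < ereal ((1 - t) * u1 + t * v1) + ereal ((1 - t) * u2 + t * v2)"
    using strictly_convex_where_finiteD[OF f xy uv(1,4) t] g[OF xy(1,2) uv(2,5) t]
      nonneg[of "(1 - t) *\<^sub>R x + t *\<^sub>R y"]
    by (cases "f ((1 - t) *\<^sub>R x + t *\<^sub>R y)"; cases "g ((1 - t) *\<^sub>R x + t *\<^sub>R y)") auto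
  then show "f ((1 - t) *\<^sub>R x + t *\<^sub>R y) + g ((1 - t) *\<^sub>R x + t *\<^sub>R y)
      < ereal ((1 - t) * u + t * v)"
    by (simp add: uv algebra_simps)
qed

text \<open>Between two distinct zeros, a strictly convex function would be negative.\<close>

lemma minimizers_eq_zero_singleton:
  fixes f :: "'a::real_vector \<Rightarrow> ereal"
  assumes f: "strictly_convex_where_finite D f" and nonneg: "\<And>x. f x \<ge> 0"
    and m: "m \<in> D" "f m = 0"
  shows "minimizers D f = {m}"
proof -
  have "x = m" if "x \<in> D" "f x = 0" for x
  proof (rule ccontr)
    assume "x \<noteq> m"
    then have "f ((1 - 1/2) *\<^sub>R x + (1/2) *\<^sub>R m) < ereal ((1 - 1/2) * 0 + 1/2 * 0)"
      using that m by (intro strictly_convex_where_finiteD[OF f]) (auto simp: zero_ereal_def)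
    then show False
      using nonneg[of "(1 - 1/2) *\<^sub>R x + (1/2) *\<^sub>R m"] by (simp flip: zero_ereal_def)
  qed
  moreover have "x \<in> minimizers D f \<longleftrightarrow> x \<in> D \<and> f x = 0" for x
  proof
    assume "x \<in> minimizers D f"
    then have "x \<in> D" "f x \<le> f m"
      using m(1) by (auto simp: minimizers_def is_arg_min_def not_less)
    then show "x \<in> D \<and> f x = 0"
      using nonneg[of x] m(2) by (metis antisym)
  next
    assume "x \<in> D \<and> f x = 0"
    then show "x \<in> minimizers D f"
      using nonneg by (auto simp: minimizers_def is_arg_min_def not_less)
  qed
  ultimately show ?thesis using m by blast
qed

section \<open>The local rate function\<close>

lemma I_L_IB_nonneg:
  assumes "b > 0" "p > 0"
  shows "I_L_IB b p \<kappa> x \<ge> 0"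
  unfolding I_L_IB_eq_INF using assms by (intro INF_greatest relative_entropy_nonneg) simp

lemma poisson_exp_moments:
  assumes "l > 0"
  shows "summable (\<lambda>k. pmf (poisson_pmf l) k * exp (c * real k))"
proof -
  have "summable (\<lambda>k. exp (- l) * (inverse (fact k) * (l * exp c) ^ k))"
    by (intro summable_mult summable_exp)
  then show ?thesis
    using assms by (simp add: field_simps power_mult_distrib exp_of_nat_mult[symmetric])
qed

lemma convex_rate_domain: "convex rate_domain"
  unfolding rate_domain_def by (intro convex_Times) auto

lemma strictly_convex_I_L_IB:
  assumes "b > 0" "p > 0"
  shows "strictly_convex_where_finite rate_domain (I_L_IB b p \<kappa>)"
proof (rule strictly_convex_where_finiteI[OF convex_rate_domain I_L_IB_nonneg[OF assms]])
  fix x y u v and t :: real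
  assume xy: "x \<noteq> y" and t: "0 < t" "t < 1"
    and Ix: "I_L_IB b p \<kappa> x = ereal u" and Iy: "I_L_IB b p \<kappa> y = ereal v"
  define \<nu> where "\<nu> = poisson_pmf (b * p)"
  have \<nu>: "set_pmf \<nu> = UNIV" using assms by (simp add: \<nu>_def)
  have moments: "summable (\<lambda>k. pmf \<nu> k * exp (c * real k))" for c
    unfolding \<nu>_def using assms by (intro poisson_exp_moments) simp
  obtain \<delta> where \<delta>: "\<delta> > 0" "\<And>\<mu>\<^sub>0 \<mu>\<^sub>1 h\<^sub>0 h\<^sub>1. has_profile \<kappa> \<mu>\<^sub>0 x \<Longrightarrow> has_profile \<kappa> \<mu>\<^sub>1 y \<Longrightarrow>
    (\<lambda>k. pmf \<mu>\<^sub>0 k * ln (pmf \<mu>\<^sub>0 k / pmf \<nu> k)) sums h\<^sub>0 \<Longrightarrow> h\<^sub>0 \<le> max u v + 1 \<Longrightarrow>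
    (\<lambda>k. pmf \<mu>\<^sub>1 k * ln (pmf \<mu>\<^sub>1 k / pmf \<nu> k)) sums h\<^sub>1 \<Longrightarrow> h\<^sub>1 \<le> max u v + 1 \<Longrightarrow>
    \<exists>k. \<bar>pmf \<mu>\<^sub>0 k - pmf \<mu>\<^sub>1 k\<bar> \<ge> \<delta>"
    using profiles_separate[OF \<nu> moments xy] by blast
  define g where "g = t * (1 - t) / 4 * \<delta>\<^sup>2"
  have g: "g > 0" using t \<delta>(1) by (simp add: g_def)
  \<comment> \<open>Near-minimizers: excess below \<open>1\<close> keeps them in the entropy ball that \<open>\<delta>\<close> belongs to,
    and excess below \<open>g\<close> is outweighed by the gap that \<open>\<delta>\<close> guarantees.\<close>
  define \<eta> where "\<eta> = min 1 g"
  have \<eta>: "\<eta> > 0" "\<eta> \<le> 1" "\<eta> \<le> g" using g by (auto simp: \<eta>_def)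
  have near: "\<exists>\<mu> h. has_profile \<kappa> \<mu> z \<and> (\<lambda>k. pmf \<mu> k * ln (pmf \<mu> k / pmf \<nu> k)) sums h \<and> h < w + \<eta>"
    if "I_L_IB b p \<kappa> z = ereal w" for z w
  proof -
    have "(INF \<mu>\<in>{\<mu>. has_profile \<kappa> \<mu> z}. relative_entropy \<mu> \<nu>) < ereal (w + \<eta>)"
      using that \<eta> by (simp add: I_L_IB_eq_INF \<nu>_def)
    then obtain \<mu> where "has_profile \<kappa> \<mu> z" "relative_entropy \<mu> \<nu> < ereal (w + \<eta>)"
      by (auto simp: INF_less_iff)
    then show ?thesis using relative_entropy_less_ereal_cases[OF \<nu>] by metis
  qed
  obtain \<mu>\<^sub>0 h\<^sub>0 where 0: "has_profile \<kappa> \<mu>\<^sub>0 x"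
    "(\<lambda>k. pmf \<mu>\<^sub>0 k * ln (pmf \<mu>\<^sub>0 k / pmf \<nu> k)) sums h\<^sub>0" "h\<^sub>0 < u + \<eta>"
    using near[OF Ix] by blast
  obtain \<mu>\<^sub>1 h\<^sub>1 where 1: "has_profile \<kappa> \<mu>\<^sub>1 y"
    "(\<lambda>k. pmf \<mu>\<^sub>1 k * ln (pmf \<mu>\<^sub>1 k / pmf \<nu> k)) sums h\<^sub>1" "h\<^sub>1 < v + \<eta>"
    using near[OF Iy] by blast
  obtain j where j: "\<bar>pmf \<mu>\<^sub>0 j - pmf \<mu>\<^sub>1 j\<bar> \<ge> \<delta>"
    using \<delta>(2)[OF 0(1) 1(1) 0(2) _ 1(2)] 0(3) 1(3) \<eta>(2) by fastforce
  have "I_L_IB b p \<kappa> ((1 - t) *\<^sub>R x + t *\<^sub>R y) \<le> relative_entropy (mixture_pmf t \<mu>\<^sub>0 \<mu>\<^sub>1) \<nu>"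
    unfolding I_L_IB_eq_INF \<nu>_def using has_profile_mixture[OF 0(1) 1(1) t]
    by (intro INF_lower) simp
  also have "\<dots> \<le> ereal ((1 - t) * h\<^sub>0 + t * h\<^sub>1 - t * (1 - t) / 4 * (pmf \<mu>\<^sub>0 j - pmf \<mu>\<^sub>1 j)\<^sup>2)"
    by (rule entropy_mixture_gap[OF \<nu> t 0(2) 1(2)])
  also have "\<dots> \<le> ereal ((1 - t) * h\<^sub>0 + t * h\<^sub>1 - g)"
  proof -
    have "\<delta>\<^sup>2 \<le> (pmf \<mu>\<^sub>0 j - pmf \<mu>\<^sub>1 j)\<^sup>2"
      using power_mono[OF j, of 2] \<delta>(1) by simp
    then show ?thesis unfolding g_def using t by (simp add: mult_left_mono)
  qed
  also have "\<dots> < ereal ((1 - t) * u + t * v)"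
  proof -
    have "(1 - t) * h\<^sub>0 < (1 - t) * (u + \<eta>)" "t * h\<^sub>1 < t * (v + \<eta>)"
      using 0(3) 1(3) t by simp_all
    moreover have "(1 - t) * (u + \<eta>) + t * (v + \<eta>) = (1 - t) * u + t * v + \<eta>"
      by (simp add: algebra_simps)
    ultimately show ?thesis using \<eta>(3) by simp
  qed
  finally show "I_L_IB b p \<kappa> ((1 - t) *\<^sub>R x + t *\<^sub>R y) < ereal ((1 - t) * u + t * v)" .
qed

lemma I_L_IB_poisson_profile:
  assumes "b > 0" "p > 0" "has_profile \<kappa> (poisson_pmf (b * p)) x"
  shows "I_L_IB b p \<kappa> x = 0"
proof (rule antisym[OF _ I_L_IB_nonneg[OF assms(1,2)]])
  have "pmf \<nu> k * ln (pmf \<nu> k / pmf \<nu> k) = 0" for k and \<nu> :: "nat pmf"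
    by (cases "pmf \<nu> k = 0") auto
  then have "relative_entropy (poisson_pmf (b * p)) (poisson_pmf (b * p)) = 0"
    unfolding relative_entropy_def by (simp only:) simp
  then show "I_L_IB b p \<kappa> x \<le> 0"
    unfolding I_L_IB_eq_INF using assms(3) by (metis INF_lower mem_Collect_eq)
qed

section \<open>The global rate function\<close>

text \<open>
  The term that the global access rule adds to the local rate function. For \<open>p = 1\<close> it is
  finite only at \<open>a = b\<close>; for \<open>p < 1\<close> the case \<open>a = b\<close> falls under the general formula, because
  \<open>0 * ln 0 = 0\<close>.
\<close>

definition access_cost :: "real \<Rightarrow> real \<Rightarrow> real \<Rightarrow> ereal" where
  "access_cost b p a =
     (if a > b \<or> (p = 1 \<and> a < b) then \<infinity>
      else ereal ((b - a) * ln ((b - a) / (b * (1 - p))) - (b - a) + b * (1 - p)))"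

lemma I_G_IB_eq_I_L_IB_plus:
  assumes "b > 0" "p > 0"
  shows "I_G_IB b p \<kappa> = (\<lambda>x. I_L_IB b p \<kappa> x + access_cost b p (fst x))"
proof
  fix x :: "real \<times> real \<times> real"
  obtain a s r where x: "x = (a, s, r)" by (cases x) auto
  have "(1 - a / b) / (1 - p) = (b - a) / (b * (1 - p))"
    using assms by (cases "p = 1") (simp_all add: field_simps)
  then show "I_G_IB b p \<kappa> x = I_L_IB b p \<kappa> x + access_cost b p (fst x)"
    using I_L_IB_nonneg[OF assms, of \<kappa> x]
    by (auto simp: I_G_IB_def access_cost_def x algebra_simps)
qed

lemma access_cost_nonneg:
  assumes "b > 0" "p \<le> 1"
  shows "access_cost b p a \<ge> 0"
  using xlnx_ge_diff[of "b - a" "b * (1 - p)"] assms by (auto simp: access_cost_def)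

lemma access_cost_zero: "p \<le> 1 \<Longrightarrow> b > 0 \<Longrightarrow> access_cost b p (b * p) = 0"
  by (cases "p = 1") (auto simp: access_cost_def right_diff_distrib mult_le_cancel_left1)

lemma access_cost_convex:
  assumes "b > 0" "p \<le> 1" "access_cost b p a = ereal u" "access_cost b p a' = ereal v"
    and t: "0 < t" "t < 1"
  shows "access_cost b p ((1 - t) * a + t * a') \<le> ereal ((1 - t) * u + t * v)"
proof (cases "p = 1")
  case True
  then have "a = b" "a' = b" "u = 0" "v = 0"
    using assms(3,4) by (auto simp: access_cost_def split: if_splits)
  moreover have "(1 - t) * b + t * b = b" by (simp add: algebra_simps)
  ultimately show ?thesis using True by (simp add: access_cost_def)
next
  case False
  define q where "q = b * (1 - p)"
  have q: "q > 0" using False assms(1,2) by (simp add: q_def)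
  have ab: "a \<le> b" "a' \<le> b"
    and u: "u = (b - a) * ln ((b - a) / q) - (b - a) + q"
    and v: "v = (b - a') * ln ((b - a') / q) - (b - a') + q"
    using assms(3,4) False by (auto simp: access_cost_def q_def split: if_splits)
  define m where "m = (1 - t) * a + t * a'"
  have m: "b - m = (1 - t) * (b - a) + t * (b - a')"
    unfolding m_def by (simp add: algebra_simps)
  have mb: "m \<le> b" unfolding m_def using convex_bound_le[OF ab, of "1 - t" t] t by simp
  define B where "B = (b - a) + (b - a') + 1"
  have B: "B > 0" "b - a \<le> B" "b - a' \<le> B" using ab by (auto simp: B_def)
  have "(b - m) * ln ((b - m) / q) \<le> (1 - t) * ((b - a) * ln ((b - a) / q))
      + t * ((b - a') * ln ((b - a') / q)) - t * (1 - t) / (4 * B) * ((b - a) - (b - a'))\<^sup>2"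
    unfolding m using ab B q t by (intro xlnx_convex_gap) auto
  also have "\<dots> \<le> (1 - t) * ((b - a) * ln ((b - a) / q)) + t * ((b - a') * ln ((b - a') / q))"
    using t B by simp
  finally have "(b - m) * ln ((b - m) / q) - (b - m) + q \<le> (1 - t) * u + t * v"
    unfolding u v m_def by (simp add: algebra_simps)
  then show ?thesis
    using False mb unfolding m_def[symmetric] by (simp add: access_cost_def q_def)
qed

lemma I_G_IB_nonneg:
  assumes "b > 0" "p > 0" "p \<le> 1"
  shows "I_G_IB b p \<kappa> x \<ge> 0"
  using I_L_IB_nonneg[OF assms(1,2)] access_cost_nonneg[OF assms(1,3)]
  by (simp add: I_G_IB_eq_I_L_IB_plus[OF assms(1,2)])

lemma strictly_convex_I_G_IB:
  assumes "b > 0" "p > 0" "p \<le> 1"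
  shows "strictly_convex_where_finite rate_domain (I_G_IB b p \<kappa>)"
  unfolding I_G_IB_eq_I_L_IB_plus[OF assms(1,2)]
proof (rule strictly_convex_where_finite_add[OF convex_rate_domain strictly_convex_I_L_IB])
  fix x y :: "real \<times> real \<times> real" and u v t :: real
  assume "access_cost b p (fst x) = ereal u" "access_cost b p (fst y) = ereal v" "0 < t" "t < 1"
  then show "access_cost b p (fst ((1 - t) *\<^sub>R x + t *\<^sub>R y)) \<le> ereal ((1 - t) * u + t * v)"
    using access_cost_convex[OF assms(1,3)] by simp
qed (use assms I_L_IB_nonneg access_cost_nonneg in auto)

section \<open>The profile of the Poisson distribution\<close>

lemma poisson_mean_shift:
  assumes "l > 0"
  shows "real (Suc k) * pmf (poisson_pmf l) (Suc k) = l * pmf (poisson_pmf l) k"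
proof -
  have "real (Suc k) * (l ^ Suc k / fact (Suc k)) = l * (l ^ k / fact k)"
    by (simp add: divide_simps del: of_nat_Suc)
  then show ?thesis using assms by (simp only: pmf_poisson less_imp_le mult.assoc[symmetric])
qed

lemma poisson_mean_sums:
  assumes "l > 0"
  shows "(\<lambda>k. real k * pmf (poisson_pmf l) k) sums l"
proof -
  have "(\<lambda>k. real (Suc k) * pmf (poisson_pmf l) (Suc k)) sums l"
    unfolding poisson_mean_shift[OF assms] using sums_mult[OF pmf_nat_sums_1, of l] by simp
  then show ?thesis by (subst (asm) sums_Suc_iff) simp
qed

lemma poisson_expectation:
  assumes "l > 0"
  shows "measure_pmf.expectation (poisson_pmf l) real = l"
proof -
  let ?f = "\<lambda>k. pmf (poisson_pmf l) k * real k"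
  have sums: "?f sums l" using poisson_mean_sums[OF assms] by (simp only: mult.commute)
  have "measure_pmf.expectation (poisson_pmf l) real = (\<integral>k. ?f k \<partial>count_space UNIV)"
    unfolding measure_pmf_eq_density by (subst integral_density) auto
  also have "\<dots> = (\<Sum>k. ?f k)"
    using sums by (intro integral_count_space_nat)
      (auto simp: integrable_count_space_nat_iff sums_iff abs_mult)
  finally show ?thesis using sums by (simp add: sums_iff)
qed

lemma expectation_truncated:
  "measure_pmf.expectation \<nu> (\<lambda>k. real k * indicator {..\<kappa>} k) = (\<Sum>k\<le>\<kappa>. real k * pmf \<nu> k)"
  by (subst integral_measure_pmf_real[of "{..\<kappa>}"]) (auto simp: indicator_def)

lemma poisson_truncated_mean:
  assumes "l > 0" "\<kappa> \<ge> 1"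
  shows "(\<Sum>k\<le>\<kappa>. real k * pmf (poisson_pmf l) k) = l * (\<Sum>k\<le>\<kappa> - 1. pmf (poisson_pmf l) k)"
proof -
  obtain n where n: "\<kappa> = Suc n" using assms(2) by (cases \<kappa>) auto
  show ?thesis
    unfolding n sum.atMost_Suc_shift poisson_mean_shift[OF assms(1)] by (simp add: sum_distrib_left)
qed

theorem corollary1p12:
  fixes b p :: real and \<kappa> :: nat
  assumes "b > 0" and "p > 0" and "\<kappa> \<ge> 1"
  shows "strictly_convex_where_finite rate_domain (I_L_IB b p \<kappa>) \<and>
    (p \<le> 1 \<longrightarrow> strictly_convex_where_finite rate_domain (I_G_IB b p \<kappa>)) \<and>
    (\<exists>a s r.
       minimizers rate_domain (I_L_IB b p \<kappa>) = {(a, s, r)} \<and>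
       (p \<le> 1 \<longrightarrow> minimizers rate_domain (I_G_IB b p \<kappa>) = {(a, s, r)}) \<and>
       a = p * b \<and>
       a = measure_pmf.expectation (poisson_pmf (b * p)) (\<lambda>k. real k) \<and>
       s = exp (- (b * p)) * (\<Sum>i=0..\<kappa>. real i * ((b * p) ^ i / fact i)) \<and>
       s = measure_pmf.expectation (poisson_pmf (b * p)) (\<lambda>k. real k * indicator {..\<kappa>} k) \<and>
       s = b * p * exp (- (b * p)) * (\<Sum>i=0..\<kappa> - 1. (b * p) ^ i / fact i) \<and>
       r = exp (- (b * p)) * (\<Sum>i=0..\<kappa>. (b * p) ^ i / fact i) \<and>
       r = measure_pmf.prob (poisson_pmf (b * p)) {0..\<kappa>})"
proof -
  define \<nu> where "\<nu> = poisson_pmf (b * p)"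
  define s where "s = (\<Sum>k\<le>\<kappa>. real k * pmf \<nu> k)"
  define r where "r = (\<Sum>k\<le>\<kappa>. pmf \<nu> k)"
  have l: "b * p > 0" using assms by simp
  have pmf_\<nu>: "pmf \<nu> k = exp (- (b * p)) * ((b * p) ^ k / fact k)" for k
    using l by (simp add: \<nu>_def)
  have r_prob: "r = measure_pmf.prob \<nu> {0..\<kappa>}"
    by (simp add: r_def measure_measure_pmf_finite atLeast0AtMost)
  have profile: "has_profile \<kappa> \<nu> (b * p, s, r)"
    using poisson_mean_sums[OF l] by (simp add: has_profile_def s_def r_def \<nu>_def)
  have dom: "(b * p, s, r) \<in> rate_domain"
    using l r_prob by (auto simp: rate_domain_def s_def intro!: sum_nonneg)
  have L0: "I_L_IB b p \<kappa> (b * p, s, r) = 0"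
    using I_L_IB_poisson_profile[OF assms(1,2)] profile by (simp add: \<nu>_def)
  have G0: "I_G_IB b p \<kappa> (b * p, s, r) = 0" if "p \<le> 1"
    using L0 access_cost_zero[OF that assms(1)] by (simp add: I_G_IB_eq_I_L_IB_plus[OF assms(1,2)])
  have "minimizers rate_domain (I_L_IB b p \<kappa>) = {(b * p, s, r)}"
    using minimizers_eq_zero_singleton[OF strictly_convex_I_L_IB[OF assms(1,2)]
      I_L_IB_nonneg[OF assms(1,2)] dom L0] .
  moreover have "minimizers rate_domain (I_G_IB b p \<kappa>) = {(b * p, s, r)}" if "p \<le> 1"
    using minimizers_eq_zero_singleton[OF strictly_convex_I_G_IB[OF assms(1,2) that]
      I_G_IB_nonneg[OF assms(1,2) that] dom G0[OF that]] .
  moreover have "b * p = measure_pmf.expectation \<nu> (\<lambda>k. real k)"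
    using poisson_expectation[OF l] by (simp add: \<nu>_def)
  moreover have "s = exp (- (b * p)) * (\<Sum>i=0..\<kappa>. real i * ((b * p) ^ i / fact i))"
    by (simp add: s_def pmf_\<nu> sum_distrib_left atLeast0AtMost mult.left_commute)
  moreover have "s = measure_pmf.expectation \<nu> (\<lambda>k. real k * indicator {..\<kappa>} k)"
    by (simp only: s_def expectation_truncated)
  moreover have "s = b * p * exp (- (b * p)) * (\<Sum>i=0..\<kappa> - 1. (b * p) ^ i / fact i)"
  proof -
    have "s = b * p * (\<Sum>k\<le>\<kappa> - 1. pmf \<nu> k)"
      unfolding s_def \<nu>_def by (rule poisson_truncated_mean[OF l assms(3)])
    then show ?thesis
      by (simp only: pmf_\<nu> sum_distrib_left[symmetric] atLeast0AtMost mult.assoc)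
  qed
  moreover have "r = exp (- (b * p)) * (\<Sum>i=0..\<kappa>. (b * p) ^ i / fact i)"
    by (simp add: r_def pmf_\<nu> sum_distrib_left atLeast0AtMost)
  ultimately show ?thesis
    using strictly_convex_I_L_IB[OF assms(1,2)] strictly_convex_I_G_IB[OF assms(1,2)] r_prob
    unfolding \<nu>_def by (intro conjI impI exI[of _ "b * p"] exI[of _ s] exI[of _ r]) (auto simp: mult.commute)
qed

end
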